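(* Let $l_1,l_2,l_3\in\mathbb{R}$ be pairwise distinct, let $k_1,k_2\in\mathbb{R}\setminus\{0\}$ and let $q\in(0,1)$. Consider the controlled fractional Stokes system on $\mathbb{R}^3$ $$\begin{cases} D_t^q u^1 = (l_2-l_3)u^2u^3 + k_1u^1,\\ D_t^q u^2 = (l_3-l_1)u^3u^1 + k_2u^2,\\ D_t^q u^3 = (l_1-l_2)u^1u^2 + k_1u^3,\end{cases}$$ and its equilibrium state $e_0=(0,0,0)$. (i) If $k_1<0$ and $k_2<0$, then $e_0$ is asymptotically stable. (ii) If $k_1>0$ and $k_2<0$, then $e_0$ is unstable. (iii) If $k_2>0$ and $k_1\in\mathbb{R}\setminus\{0\}$, then $e_0$ is unstable.
   Context: $u^1,u^2,u^3$ denote the components of $u$ (superscripts are indices, not powers). For $q\in(0,1)$, $D_t^q$ is the Caputo fractional derivative of order $q$: $D_t^q f(t)=\frac{1}{\Gamma(1-q)}\int_0^t (t-s)^{-q}f'(s)\,ds$. For a fractional system $D_t^q x^i(t)=f_i(x^1(t),\dots,x^n(t))$, $i=1,\dots,n$, with $f_i\in C^\infty(\mathbb{R}^n,\mathbb{R})$, a point $x_e\in\mathbb{R}^n$ is an equilibrium state if $f_i(x_e)=0$ for all $i$. The equilibrium state $x_e$ is (locally) stable if for every $\varepsilon>0$ there is $\delta>0$ such that every solution with $\|x(0)-x_e\|<\delta$ satisfies $\|x(t)-x_e\|<\varepsilon$ for all $t>0$; it is (locally) asymptotically stable if it is stable and $\lim_{t\to\infty}\|x(t)-x_e\|=0$ for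 all solutions starting sufficiently close to $x_e$; it is unstable if it is not stable. Here $\|\cdot\|$ is the Euclidean norm. *)

theory Defs
  imports "HOL-Analysis.Analysis"
begin

text \<open>The open interval is used because \<open>f\<close> is in general not differentiable at the end point \<open>0\<close>:
  solutions of fractional systems typically behave like \<open>f 0 + c * s powr q\<close> near \<open>0\<close>.\<close>

definition caputo_deriv :: "real \<Rightarrow> (real \<Rightarrow> real) \<Rightarrow> real \<Rightarrow> real" where
  "caputo_deriv q f t =
     1 / Gamma (1 - q) * (LBINT s:{0<..<t}. (t - s) powr (- q) * deriv f s)"

text \<open>\<^const>\<open>caputo_deriv\<close> is total, so its value is meaningful only under the following condition.
  Since \<open>(t - s) powr (- q) \<ge> t powr (- q)\<close> for \<open>q > 0\<close>, it makes \<open>deriv f\<close> integrable on \<open>(0, t)\<close>;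
  together with continuity at \<open>0\<close> and differentiability everywhere inside, \<open>f\<close> is then absolutely
  continuous on \<open>[0, a]\<close> for every \<open>a < t\<close>.\<close>

definition caputo_differentiable :: "real \<Rightarrow> (real \<Rightarrow> real) \<Rightarrow> real \<Rightarrow> bool" where
  "caputo_differentiable q f t \<longleftrightarrow>
     continuous_on {0..t} f \<and>
     (\<forall>s\<in>{0<..<t}. f differentiable (at s)) \<and>
     set_integrable lborel {0<..<t} (\<lambda>s. (t - s) powr (- q) * deriv f s)"

text \<open>Solutions are defined on \<open>[0, \<infinity>)\<close>; the values \<open>x t\<close> for \<open>t < 0\<close> play no role.\<close>

definition fractional_solution ::
    "real \<Rightarrow> (real^'n \<Rightarrow> real^'n) \<Rightarrow> (real \<Rightarrow> real^'n) \<Rightarrow> bool" where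
  "fractional_solution q F x \<longleftrightarrow>
     (\<forall>i. \<forall>t>0. caputo_differentiable q (\<lambda>s. x s $ i) t \<and>
                caputo_deriv q (\<lambda>s. x s $ i) t = F (x t) $ i)"

definition equilibrium_state :: "(real^'n \<Rightarrow> real^'n) \<Rightarrow> real^'n \<Rightarrow> bool" where
  "equilibrium_state F xe \<longleftrightarrow> (\<forall>i. F xe $ i = 0)"

definition stable_equilibrium :: "real \<Rightarrow> (real^'n \<Rightarrow> real^'n) \<Rightarrow> real^'n \<Rightarrow> bool" where
  "stable_equilibrium q F xe \<longleftrightarrow>
     equilibrium_state F xe \<and>
     (\<forall>\<epsilon>>0. \<exists>\<delta>>0. \<forall>x. fractional_solution q F x \<and> norm (x 0 - xe) < \<delta> \<longrightarrow>
        (\<forall>t>0. norm (x t - xe) < \<epsilon>))"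

definition asymptotically_stable_equilibrium ::
    "real \<Rightarrow> (real^'n \<Rightarrow> real^'n) \<Rightarrow> real^'n \<Rightarrow> bool" where
  "asymptotically_stable_equilibrium q F xe \<longleftrightarrow>
     stable_equilibrium q F xe \<and>
     (\<exists>\<delta>>0. \<forall>x. fractional_solution q F x \<and> norm (x 0 - xe) < \<delta> \<longrightarrow>
        ((\<lambda>t. norm (x t - xe)) \<longlongrightarrow> 0) at_top)"

definition unstable_equilibrium :: "real \<Rightarrow> (real^'n \<Rightarrow> real^'n) \<Rightarrow> real^'n \<Rightarrow> bool" where
  "unstable_equilibrium q F xe \<longleftrightarrow> equilibrium_state F xe \<and> \<not> stable_equilibrium q F xe"

definition controlled_stokes ::
    "real \<Rightarrow> real \<Rightarrow> real \<Rightarrow> real \<Rightarrow> real \<Rightarrow> real^3 \<Rightarrow> real^3" where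
  "controlled_stokes l1 l2 l3 k1 k2 u = vector
     [(l2 - l3) * (u $ 2) * (u $ 3) + k1 * (u $ 1),
      (l3 - l1) * (u $ 3) * (u $ 1) + k2 * (u $ 2),
      (l1 - l2) * (u $ 1) * (u $ 2) + k1 * (u $ 3)]"

end

theory Submission
  imports Defs "HOL-Real_Asymp.Real_Asymp"
begin

text \<open>
  Since \<open>(l2 - l3) + (l3 - l1) + (l1 - l2) = 0\<close>, the quadratic terms cancel in \<open>u \<bullet> F u\<close>, so for
  negative \<open>k1\<close>, \<open>k2\<close> we have \<open>u \<bullet> F u \<le> - \<kappa> * (norm u)\<^sup>2\<close>. Hence \<open>norm (x t)\<close> cannot reach a positive
  supersolution \<open>\<rho>\<close> of \<open>D\<^sup>q \<rho> = - \<kappa> * \<rho>\<close> that starts above \<open>norm (x 0)\<close>: at a first contact time \<open>t\<close>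
  the function \<open>w s = \<rho> t * \<rho> s - x t \<bullet> x s\<close> is nonnegative on \<open>[0, t]\<close>, vanishes at \<open>t\<close> and is positive
  at \<open>0\<close>, which forces its Caputo derivative at \<open>t\<close> to be negative. The power
  \<open>r * ((t + T) / T) powr (- q / 2)\<close> is such a supersolution for large \<open>T\<close>; it is bounded by \<open>r\<close> and
  tends to \<open>0\<close>.

  The coordinate axes are invariant and the system is linear on them, so for positive \<open>k\<close> the
  unbounded function \<open>t \<mapsto> c * (\<Sum>n. (k * t powr q) ^ n / Gamma (n * q + 1))\<close> gives solutions that start
  arbitrarily close to \<open>0\<close> and escape.
\<close>

section \<open>The Caputo integral at an extremum\<close>

text \<open>Integrating by parts on \<open>[0, r]\<close> with \<open>r < t\<close> avoids the
  singularity of the kernel, and letting \<open>r\<close> tend to \<open>t\<close> kills the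
  boundary term there. The boundary term at \<open>0\<close> is kept because it is the source of
  strictness in the comparison argument.\<close>

lemma abel_kernel_extremum:
  fixes w w' :: "real \<Rightarrow> real"
  assumes "0 < q" "q < 1" "0 < t"
    and cont: "continuous_on {0..t} w"
    and deriv: "\<And>s. 0 < s \<Longrightarrow> s \<le> t \<Longrightarrow> (w has_real_derivative w' s) (at s)"
    and nonneg: "\<And>s. 0 \<le> s \<Longrightarrow> s < t \<Longrightarrow> 0 \<le> w s"
    and "w t = 0"
    and int: "set_integrable lborel {0<..<t} (\<lambda>s. (t - s) powr (- q) * w' s)"
  shows "(LBINT s:{0<..<t}. (t - s) powr (- q) * w' s) \<le> - (t powr (- q) * w 0)"
proof -
  define \<phi> where "\<phi> s = (t - s) powr (- q) * w' s" for s
  define G where "G s = (t - s) powr (- q) * w s" for s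
  have \<phi>_int: "\<phi> integrable_on {0..t}"
    and eq: "(LBINT s:{0<..<t}. \<phi> s) = integral {0..t} \<phi>"
    using set_borel_integral_eq_integral[OF int]
    by (simp_all add: \<phi>_def[abs_def] integrable_on_Icc_iff_Ioo integral_open_interval_real)
  \<comment> \<open>Integration by parts, where the term \<open>q * (t - s) powr (- q - 1) * w s\<close> is dropped by its sign.\<close>
  have le: "integral {0..r} \<phi> \<le> G r - G 0" if r: "r \<in> {0<..<t}" for r
  proof -
    have "((\<lambda>s. \<phi> s + q * (t - s) powr (- q - 1) * w s) has_integral G r - G 0) {0..r}"
    \<comment> \<open>The interior version asks only for continuity of \<open>G\<close> at the end
      point \<open>0\<close>, where \<open>w\<close> need not be differentiable.\<close>
    proof (rule fundamental_theorem_of_calculus_interior)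
      show "continuous_on {0..r} G"
        unfolding G_def using r
        by (auto intro!: continuous_intros continuous_on_subset[OF cont])
      fix s assume s: "s \<in> {0<..<r}"
      show "(G has_vector_derivative \<phi> s + q * (t - s) powr (- q - 1) * w s) (at s)"
        unfolding G_def \<phi>_def has_real_derivative_iff_has_vector_derivative [symmetric]
        using s r by (auto intro!: derivative_eq_intros deriv simp: algebra_simps)
    qed (use r in auto)
    moreover have "\<phi> integrable_on {0..r}"
      using \<phi>_int r by (auto intro: integrable_on_subinterval)
    ultimately have "((\<lambda>s. q * (t - s) powr (- q - 1) * w s) has_integral
        G r - G 0 - integral {0..r} \<phi>) {0..r}"
      by (auto dest: has_integral_diff[OF _ integrable_integral])
    then have "0 \<le> G r - G 0 - integral {0..r} \<phi>"
      by (rule has_integral_nonneg) (use nonneg r \<open>0 < q\<close> in auto)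
    then show ?thesis by simp
  qed
  have "((\<lambda>r. integral {0..r} \<phi>) \<longlongrightarrow> integral {0..t} \<phi>) (at_left t)"
  proof -
    have "((\<lambda>r. integral {0..r} \<phi>) \<longlongrightarrow> integral {0..t} \<phi>) (at t within {0..t})"
      using indefinite_integral_continuous_1[OF \<phi>_int] \<open>0 < t\<close> by (auto simp: continuous_on_def)
    then show ?thesis
      using \<open>0 < t\<close> by (simp add: at_within_Icc_at_left)
  qed
  moreover have "(G \<longlongrightarrow> 0) (at_left t)"
    \<comment> \<open>Differentiability at \<open>t\<close> gives \<open>w r = O(t - r)\<close>, which beats the kernel because \<open>q < 1\<close>.\<close>
  proof -
    have "((\<lambda>r. (w r - w t) / (r - t)) \<longlongrightarrow> w' t) (at_left t)"
      using deriv[of t] \<open>0 < t\<close> unfolding has_field_derivative_iff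
      by (auto intro: filterlim_mono at_le)
    moreover have "((\<lambda>r. (t - r) powr (1 - q)) \<longlongrightarrow> 0) (at_left t)"
      using \<open>q < 1\<close> by real_asymp
    ultimately have "((\<lambda>r. - ((t - r) powr (1 - q)) * ((w r - w t) / (r - t))) \<longlongrightarrow> - 0 * w' t) (at_left t)"
      by (intro tendsto_intros)
    moreover have "eventually (\<lambda>r. - ((t - r) powr (1 - q)) * ((w r - w t) / (r - t)) = G r) (at_left t)"
      using eventually_at_left_real[OF \<open>0 < t\<close>]
    proof eventually_elim
      case (elim r)
      have "(t - r) powr (1 - q) = (t - r) * (t - r) powr (- q)"
        using elim by (simp add: powr_diff powr_minus field_simps)
      moreover have "w r / (r - t) = - (w r / (t - r))"
        using minus_divide_right[of "w r" "t - r"] by simp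
      ultimately show ?case using elim \<open>w t = 0\<close> by (simp add: G_def)
    qed
    ultimately show ?thesis by (simp add: tendsto_cong)
  qed
  ultimately have "integral {0..t} \<phi> \<le> 0 - G 0"
    by (intro tendsto_le[OF _ tendsto_diff[OF _ tendsto_const]])
       (auto intro: le eventually_mono[OF eventually_at_left_real[OF \<open>0 < t\<close>]])
  then show ?thesis by (simp add: eq[unfolded \<phi>_def] \<phi>_def[abs_def] G_def)
qed

section \<open>Weakly singular integrals of powers\<close>

text \<open>The substitution \<open>s = t * u\<close> reduces this to Euler's Beta integral. Using
  \<open>has_bochner_integral\<close> delivers integrability and value together; for
  \<open>b < 1\<close> the integrand is singular at both ends.\<close>

lemma has_bochner_integral_abel_kernel:
  fixes t q b :: real
  assumes "0 < t" "q < 1" "0 < b"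
  shows "has_bochner_integral lborel
    (\<lambda>s. indicator {0<..<t} s * ((t - s) powr (- q) * s powr (b - 1)))
    (t powr (b - q) * Beta b (1 - q))"
proof -
  define g where "g s = s powr (b - 1) * (1 - s) powr (- q)" for s :: real
  have *: "set_integrable lborel {0<..<1} g"
    using integrable_Beta[of b "1 - q"] assms
    by (auto simp: g_def[abs_def] intro: set_integrable_subset)
  moreover have "integral {0<..<1} g = Beta b (1 - q)"
    using has_integral_Beta_real[of b "1 - q"] assms
    by (simp add: has_integral_Icc_iff_Ioo g_def[abs_def] integral_unique)
  ultimately have "has_bochner_integral lborel (\<lambda>s. indicator {0<..<1} s * g s) (Beta b (1 - q))"
    using set_borel_integral_eq_integral(2)[OF *]
    by (simp add: has_bochner_integral_iff set_integrable_def set_lebesgue_integral_def)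
  then have "has_bochner_integral lborel (\<lambda>s. indicator {0<..<1} (0 + (1 / t) * s) * g (0 + (1 / t) * s))
      (Beta b (1 - q) /\<^sub>R \<bar>1 / t\<bar>)"
    by (subst (asm) lborel_has_bochner_integral_real_affine_iff[where c = "1 / t" and t = 0])
       (use \<open>0 < t\<close> in auto)
  then have "has_bochner_integral lborel
      (\<lambda>s. t powr (b - 1 - q) * (indicator {0<..<1} (0 + (1 / t) * s) * g (0 + (1 / t) * s)))
      (t powr (b - 1 - q) * (Beta b (1 - q) /\<^sub>R \<bar>1 / t\<bar>))"
    by (rule has_bochner_integral_mult_right)
  moreover have "t powr (b - 1 - q) * (indicator {0<..<1} (0 + (1 / t) * s) * g (0 + (1 / t) * s)) =
      indicator {0<..<t} s * ((t - s) powr (- q) * s powr (b - 1))" for s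
  proof (cases "s \<in> {0<..<t}")
    case True
    have "1 - s / t = (t - s) / t"
      using \<open>0 < t\<close> by (simp add: field_simps)
    moreover have "t powr (b - 1 - q) = t powr (b - 1) * t powr (- q)"
      by (simp flip: powr_add)
    ultimately show ?thesis
      using True by (simp add: g_def powr_divide)
  qed (use \<open>0 < t\<close> in \<open>auto simp: indicator_def field_simps\<close>)
  moreover have "t powr (b - 1 - q) * (Beta b (1 - q) /\<^sub>R \<bar>1 / t\<bar>) = t powr (b - q) * Beta b (1 - q)"
  proof -
    have "t powr (b - q) = t powr (b - 1 - q) * t"
      using \<open>0 < t\<close> powr_add[of t "b - 1 - q" 1] by simp
    then show ?thesis using \<open>0 < t\<close> by simp
  qed
  ultimately show ?thesis by (simp only:)
qed

text \<open>Splitting off \<open>(s + T) powr (- q) \<le> T powr (- q)\<close> leaves the exponent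
  \<open>q - a - 1\<close>, for which the Beta integral over the shifted interval
  \<open>(0, t + T)\<close> is exactly of order \<open>(t + T) powr (- a)\<close>. It converges
  because \<open>a < q\<close>. The factor \<open>T powr (- q)\<close> is what can later be adjusted
  through \<open>T\<close>.\<close>

lemma abel_kernel_shifted_power:
  fixes a q t T :: real
  assumes "0 < a" "a < q" "q < 1" "0 < T" "0 < t"
  shows "set_integrable lborel {0<..<t} (\<lambda>s. (t - s) powr (- q) * (s + T) powr (- a - 1))" (is ?int)
    and "(LBINT s:{0<..<t}. (t - s) powr (- q) * (s + T) powr (- a - 1))
          \<le> T powr (- q) * Beta (q - a) (1 - q) * (t + T) powr (- a)" (is ?le)
proof -
  define K where "K s = indicator {0<..<t + T} s * ((t + T - s) powr (- q) * s powr (q - a - 1))"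
    for s :: real
  define f where "f s = indicator {0<..<t} s *\<^sub>R ((t - s) powr (- q) * (s + T) powr (- a - 1))"
    for s :: real
  have "has_bochner_integral lborel K ((t + T) powr (- a) * Beta (q - a) (1 - q))"
    using has_bochner_integral_abel_kernel[of "t + T" q "q - a"] assms by (simp add: K_def[abs_def])
  then have "has_bochner_integral lborel (\<lambda>s. K (T + 1 * s)) ((t + T) powr (- a) * Beta (q - a) (1 - q))"
    by (subst (asm) lborel_has_bochner_integral_real_affine_iff[where c = 1 and t = T]) auto
  then have K: "has_bochner_integral lborel (\<lambda>s. T powr (- q) * K (T + 1 * s))
      (T powr (- q) * ((t + T) powr (- a) * Beta (q - a) (1 - q)))"
    by (rule has_bochner_integral_mult_right)
  \<comment> \<open>\<open>K (T + 1 * s)\<close> lives on \<open>-T < s < t\<close>, so the bound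
    also adds the nonnegative contribution of \<open>-T < s \<le> 0\<close>.\<close>
  have bound: "f s \<le> T powr (- q) * K (T + 1 * s)" for s
  proof (cases "s \<in> {0<..<t}")
    case True
    have "(s + T) powr (- a - 1) = (s + T) powr (- q) * (s + T) powr (q - a - 1)"
      by (simp flip: powr_add)
    also have "\<dots> \<le> T powr (- q) * (s + T) powr (q - a - 1)"
      using True assms by (intro mult_right_mono powr_mono2') auto
    finally have "(t - s) powr (- q) * (s + T) powr (- a - 1)
        \<le> (t - s) powr (- q) * (T powr (- q) * (s + T) powr (q - a - 1))"
      by (rule mult_left_mono) simp
    then show ?thesis
      using True assms by (simp add: f_def K_def algebra_simps)
  qed (simp add: f_def K_def)
  have f: "integrable lborel f"
  proof (rule Bochner_Integration.integrable_bound)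
    show "integrable lborel (\<lambda>s. T powr (- q) * K (T + 1 * s))"
      using K by (simp add: has_bochner_integral_iff)
    show "f \<in> borel_measurable lborel"
      unfolding f_def by measurable
    show "AE s in lborel. norm (f s) \<le> norm (T powr (- q) * K (T + 1 * s))"
    proof (rule AE_I2)
      fix s
      have "0 \<le> f s" by (simp add: f_def)
      with bound[of s] show "norm (f s) \<le> norm (T powr (- q) * K (T + 1 * s))" by simp
    qed
  qed
  then show ?int by (simp add: set_integrable_def f_def[abs_def])
  have "integral\<^sup>L lborel f \<le> integral\<^sup>L lborel (\<lambda>s. T powr (- q) * K (T + 1 * s))"
    using f K bound by (intro integral_mono) (auto simp: has_bochner_integral_iff)
  also have "\<dots> = T powr (- q) * ((t + T) powr (- a) * Beta (q - a) (1 - q))"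
    using K by (simp add: has_bochner_integral_iff)
  finally show ?le
    by (simp add: set_lebesgue_integral_def f_def[abs_def] mult_ac)
qed

section \<open>Comparison with a supersolution and asymptotic stability\<close>

lemma fractional_solution_comparison:
  fixes x :: "real \<Rightarrow> real^'n" and \<rho> \<rho>' :: "real \<Rightarrow> real"
  assumes q: "0 < q" "q < 1"
    and sol: "fractional_solution q F x"
    and dissipative: "\<And>u. u \<bullet> F u \<le> - \<kappa> * (norm u)\<^sup>2"
    and cont: "continuous_on {0..} \<rho>"
    and deriv: "\<And>s. 0 < s \<Longrightarrow> (\<rho> has_real_derivative \<rho>' s) (at s)"
    and pos: "\<And>s. 0 \<le> s \<Longrightarrow> 0 < \<rho> s"
    and int: "\<And>t. 0 < t \<Longrightarrow> set_integrable lborel {0<..<t} (\<lambda>s. (t - s) powr (- q) * \<rho>' s)"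
    and super: "\<And>t. 0 < t \<Longrightarrow> - \<kappa> * Gamma (1 - q) * \<rho> t \<le> (LBINT s:{0<..<t}. (t - s) powr (- q) * \<rho>' s)"
    and init: "norm (x 0) < \<rho> 0"
    and "0 \<le> T"
  shows "norm (x T) < \<rho> T"
proof (rule ccontr)
  assume contra: "\<not> norm (x T) < \<rho> T"
  define d where "d i = deriv (\<lambda>s. x s $ i)" for i
  have comp_cont: "continuous_on {0..t} (\<lambda>s. x s $ i)" if "0 < t" for t i
    using sol that by (auto simp: fractional_solution_def caputo_differentiable_def)
  \<comment> \<open>Caputo differentiability up to a time gives derivatives only strictly before it,
    so it is invoked at \<open>s + 1\<close>.\<close>
  have comp_deriv: "((\<lambda>s. x s $ i) has_real_derivative d i s) (at s)" if "0 < s" for s i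
    using sol that
    by (auto simp: fractional_solution_def caputo_differentiable_def d_def DERIV_deriv_iff_real_differentiable
        dest!: spec[of _ i] spec[of _ "s + 1"])
  have x_cont: "continuous_on {0..t} x" if "0 < t" for t
    using continuous_on_vec_lambda[of "{0..t}" "\<lambda>i s. x s $ i"] comp_cont[OF that] by simp
  have "T > 0" using contra init \<open>0 \<le> T\<close> by (cases "T = 0") auto
  define S where "S = {s \<in> {0..T}. \<rho> s \<le> norm (x s)}"
  have "continuous_on {0..T} \<rho>"
    by (rule continuous_on_subset[OF cont]) auto
  then have "closed S"
    unfolding S_def using x_cont[OF \<open>T > 0\<close>]
    by (intro continuous_on_closed_Collect_le continuous_intros) auto
  moreover have "S \<noteq> {}" "bdd_below S"
    using contra \<open>0 \<le> T\<close> by (auto simp: S_def intro!: exI[of _ T] bdd_belowI[of _ 0])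
  moreover define t where "t = Inf S"
  ultimately have "t \<in> S" and below: "\<And>s. s \<in> S \<Longrightarrow> t \<le> s"
    by (auto intro: closed_contains_Inf cInf_lower)
  then have t: "0 < t" "\<rho> t \<le> norm (x t)" "t \<le> T"
    using init by (auto simp: S_def intro: le_neq_trans)
  have less: "norm (x s) < \<rho> s" if "0 \<le> s" "s < t" for s
    using below[of s] that t by (force simp: S_def)
  have eq: "norm (x t) = \<rho> t"
  proof (rule antisym)
    have c: "continuous_on {0..t} (\<lambda>s. \<rho> s - norm (x s))"
      using x_cont[OF t(1)] continuous_on_subset[OF cont, of "{0..t}"] by (intro continuous_intros) auto
    then have "((\<lambda>s. \<rho> s - norm (x s)) \<longlongrightarrow> \<rho> t - norm (x t)) (at_left t)"
      using t by (auto simp: continuous_on_def simp flip: at_within_Icc_at_left[of 0 t])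
    then have "0 \<le> \<rho> t - norm (x t)"
      by (rule tendsto_lowerbound)
         (auto intro!: eventually_mono[OF eventually_at_left_real[OF t(1)]] less_imp_le less)
    then show "norm (x t) \<le> \<rho> t" by simp
  qed (rule t)
  define w where "w s = \<rho> t * \<rho> s - (\<Sum>i\<in>UNIV. x t $ i * x s $ i)" for s
  define w' where "w' s = \<rho> t * \<rho>' s - (\<Sum>i\<in>UNIV. x t $ i * d i s)" for s
  have w_inner: "w s = \<rho> t * \<rho> s - x t \<bullet> x s" for s
    by (simp add: w_def inner_vec_def)
  \<comment> \<open>Cauchy-Schwarz and \<open>norm (x t) = \<rho> t\<close> transfer the sign of
    \<open>\<rho> - norm x\<close> to \<open>w\<close>: nonnegative before \<open>t\<close>,
    strictly positive at \<open>0\<close>.\<close>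
  have w_ge: "\<rho> t * (\<rho> s - norm (x s)) \<le> w s" for s
    using norm_cauchy_schwarz[of "x t" "x s"] by (simp add: w_inner eq algebra_simps)
  let ?I = "LBINT s:{0<..<t}. (t - s) powr (- q) * \<rho>' s"
  have G: "Gamma (1 - q) \<noteq> 0"
    using q Gamma_real_pos[of "1 - q"] by linarith
  have comp_int: "has_bochner_integral lborel
      (\<lambda>s. indicator {0<..<t} s * ((t - s) powr (- q) * d i s)) (Gamma (1 - q) * F (x t) $ i)" for i
    using sol t G
    by (auto simp: fractional_solution_def caputo_differentiable_def caputo_deriv_def d_def
        set_integrable_def set_lebesgue_integral_def has_bochner_integral_iff field_simps
        dest!: spec[of _ i] spec[of _ t])
  have "has_bochner_integral lborel
      (\<lambda>s. indicator {0<..<t} s * ((t - s) powr (- q) * \<rho>' s)) ?I"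
    using int[OF t(1)] by (simp add: set_integrable_def set_lebesgue_integral_def has_bochner_integral_iff)
  then have "has_bochner_integral lborel
      (\<lambda>s. \<rho> t * (indicator {0<..<t} s * ((t - s) powr (- q) * \<rho>' s)) -
        (\<Sum>i\<in>UNIV. x t $ i * (indicator {0<..<t} s * ((t - s) powr (- q) * d i s))))
      (\<rho> t * ?I - (\<Sum>i\<in>UNIV. x t $ i * (Gamma (1 - q) * F (x t) $ i)))"
    by (intro has_bochner_integral_diff has_bochner_integral_sum has_bochner_integral_mult_right comp_int)
  moreover have "(\<Sum>i\<in>UNIV. x t $ i * (Gamma (1 - q) * F (x t) $ i)) = Gamma (1 - q) * (x t \<bullet> F (x t))"
    by (simp add: inner_vec_def sum_distrib_left mult_ac)
  ultimately have w'_int: "has_bochner_integral lborel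
      (\<lambda>s. indicator {0<..<t} s * ((t - s) powr (- q) * w' s))
      (\<rho> t * ?I - Gamma (1 - q) * (x t \<bullet> F (x t)))"
    by (simp add: w'_def right_diff_distrib sum_distrib_left mult_ac)
  have "(LBINT s:{0<..<t}. (t - s) powr (- q) * w' s) \<le> - (t powr (- q) * w 0)"
  proof (rule abel_kernel_extremum[OF q t(1)])
    show "continuous_on {0..t} w"
      unfolding w_def using comp_cont[OF t(1)] x_cont[OF t(1)] continuous_on_subset[OF cont, of "{0..t}"]
      by (intro continuous_intros) auto
    show "(w has_real_derivative w' s) (at s)" if "0 < s" "s \<le> t" for s
      unfolding w_def w'_def using that
      by (auto intro!: derivative_eq_intros deriv comp_deriv sum.cong)
    show "0 \<le> w s" if "0 \<le> s" "s < t" for s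
      using w_ge[of s] less[OF that] pos[of t] t(1)
      by (smt (verit) mult_nonneg_nonneg)
    show "w t = 0"
      by (simp add: w_inner power2_norm_eq_inner[symmetric] eq power2_eq_square)
    show "set_integrable lborel {0<..<t} (\<lambda>s. (t - s) powr (- q) * w' s)"
      using w'_int by (simp add: set_integrable_def has_bochner_integral_iff)
  qed
  \<comment> \<open>Strictness comes from the initial gap \<open>norm (x 0) < \<rho> 0\<close>. The
    estimates that follow lead from \<open>\<rho> t * ?I\<close> back to itself through
    dissipativity and \<open>super\<close>, which is absurd.\<close>
  also have "\<dots> < 0"
    using w_ge[of 0] init pos[of t] t(1) by (smt (verit) mult_pos_pos powr_gt_zero)
  also have "(LBINT s:{0<..<t}. (t - s) powr (- q) * w' s) = \<rho> t * ?I - Gamma (1 - q) * (x t \<bullet> F (x t))"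
    using w'_int by (simp add: set_lebesgue_integral_def has_bochner_integral_iff)
  finally have "\<rho> t * ?I < Gamma (1 - q) * (x t \<bullet> F (x t))" by simp
  also have "\<dots> \<le> Gamma (1 - q) * (- \<kappa> * (\<rho> t)\<^sup>2)"
    using dissipative[of "x t"] q by (intro mult_left_mono) (auto simp: eq)
  also have "\<dots> = \<rho> t * (- \<kappa> * Gamma (1 - q) * \<rho> t)"
    by (simp add: power2_eq_square)
  also have "\<dots> \<le> \<rho> t * ?I"
    using super[OF t(1)] pos[of t] t(1) by (intro mult_left_mono) auto
  finally show False by simp
qed

text \<open>A single \<open>T\<close>, depending only on \<open>q\<close> and
  \<open>\<kappa>\<close>, serves all solutions and all \<open>r\<close>, because the supersolution
  inequality is linear in \<open>\<rho>\<close>. The exponent \<open>q / 2\<close> is a convenient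
  choice from the interval \<open>(0, q)\<close> in which \<open>abel_kernel_shifted_power\<close>
  applies.\<close>

lemma fractional_solution_decay:
  fixes F :: "real^'n \<Rightarrow> real^'n"
  assumes q: "0 < q" "q < 1" and "0 < \<kappa>"
    and dissipative: "\<And>u. u \<bullet> F u \<le> - \<kappa> * (norm u)\<^sup>2"
  obtains T where "0 < T"
    and "\<And>x r t. fractional_solution q F x \<Longrightarrow> norm (x 0) < r \<Longrightarrow> 0 \<le> t \<Longrightarrow>
           norm (x t) < r * ((t + T) / T) powr (- q / 2)"
proof -
  define a where "a = q / 2"
  have a: "0 < a" "a < q" using q by (auto simp: a_def)
  define B where "B = Beta (q - a) (1 - q)"
  have "0 < B" using a q by (simp add: B_def Beta_def)
  have G: "0 < Gamma (1 - q)" using q by simp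
  \<comment> \<open>\<open>T\<close> solves \<open>T_eq\<close>, which turns the kernel bound into
    exactly the supersolution inequality.\<close>
  define T where "T = (a * B / (\<kappa> * Gamma (1 - q))) powr (1 / q)"
  have "0 < T" using \<open>0 < B\<close> G a \<open>0 < \<kappa>\<close> by (simp add: T_def)
  have T_eq: "a * (T powr (- q) * B) = \<kappa> * Gamma (1 - q)"
    using \<open>0 < B\<close> G a \<open>0 < \<kappa>\<close> q by (simp add: T_def powr_powr powr_minus field_simps)
  have "norm (x t) < r * ((t + T) / T) powr (- a)"
    if sol: "fractional_solution q F x" and r: "norm (x 0) < r" and "0 \<le> t" for x r t
  proof -
    have "0 < r" using r by (smt (verit) norm_ge_zero)
    \<comment> \<open>This normalises the comparison function to the value \<open>r\<close> at time
      \<open>0\<close>.\<close>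
    define c where "c = r * T powr a"
    have "0 < c" using \<open>0 < r\<close> \<open>0 < T\<close> by (simp add: c_def)
    have "norm (x t) < c * (t + T) powr (- a)"
    proof (rule fractional_solution_comparison[OF q sol dissipative _ _ _ _ _ _ \<open>0 \<le> t\<close>,
          where \<rho> = "\<lambda>t. c * (t + T) powr (- a)" and \<rho>' = "\<lambda>s. - (c * a) * (s + T) powr (- a - 1)"])
      show "continuous_on {0..} (\<lambda>t. c * (t + T) powr (- a))"
        using \<open>0 < T\<close> by (auto intro!: continuous_intros)
      show "((\<lambda>t. c * (t + T) powr (- a)) has_real_derivative - (c * a) * (s + T) powr (- a - 1)) (at s)"
        if "0 < s" for s
        using that \<open>0 < T\<close> by (auto intro!: derivative_eq_intros)
      show "0 < c * (s + T) powr (- a)" if "0 \<le> s" for s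
        using that \<open>0 < T\<close> \<open>0 < c\<close> by simp
      show "norm (x 0) < c * (0 + T) powr (- a)"
        using r \<open>0 < T\<close> by (simp add: c_def powr_minus field_simps)
      fix t :: real assume "0 < t"
      note I = abel_kernel_shifted_power[OF a q(2) \<open>0 < T\<close> \<open>0 < t\<close>]
      have *: "(t - s) powr (- q) * (- (c * a) * (s + T) powr (- a - 1)) =
          - (c * a) * ((t - s) powr (- q) * (s + T) powr (- a - 1))" for s
        by simp
      show "set_integrable lborel {0<..<t} (\<lambda>s. (t - s) powr (- q) * (- (c * a) * (s + T) powr (- a - 1)))"
        unfolding * by (intro set_integrable_mult_right I)
      have "c * a * (LBINT s:{0<..<t}. (t - s) powr (- q) * (s + T) powr (- a - 1))
          \<le> c * a * (T powr (- q) * B * (t + T) powr (- a))"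
        using I(2) \<open>0 < c\<close> a by (intro mult_left_mono) (auto simp: B_def)
      also have "\<dots> = c * (a * (T powr (- q) * B)) * (t + T) powr (- a)"
        by simp
      also have "\<dots> = \<kappa> * Gamma (1 - q) * (c * (t + T) powr (- a))"
        unfolding T_eq by simp
      finally show "- \<kappa> * Gamma (1 - q) * (c * (t + T) powr (- a)) \<le>
          (LBINT s:{0<..<t}. (t - s) powr (- q) * (- (c * a) * (s + T) powr (- a - 1)))"
        unfolding * set_integral_mult_right by simp
    qed
    also have "\<dots> = r * ((t + T) / T) powr (- a)"
      using \<open>0 < T\<close> \<open>0 \<le> t\<close> by (simp add: c_def powr_divide powr_minus field_simps)
    finally show ?thesis .
  qed
  then show thesis
    using that[OF \<open>0 < T\<close>] by (simp add: a_def)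
qed

text \<open>The power factor is at most \<open>1\<close>, so \<open>\<delta> = \<epsilon>\<close>
  works for stability. It tends to \<open>0\<close>, so every solution is attracted and the radius
  \<open>1\<close> supplied at the end is arbitrary.\<close>

lemma asymptotically_stable_if_dissipative:
  fixes F :: "real^'n \<Rightarrow> real^'n"
  assumes q: "0 < q" "q < 1" and "0 < \<kappa>" and "F 0 = 0"
    and dissipative: "\<And>u. u \<bullet> F u \<le> - \<kappa> * (norm u)\<^sup>2"
  shows "asymptotically_stable_equilibrium q F 0"
proof -
  obtain T where "0 < T"
    and decay: "\<And>x r t. fractional_solution q F x \<Longrightarrow> norm (x 0) < r \<Longrightarrow> 0 \<le> t \<Longrightarrow>
           norm (x t) < r * ((t + T) / T) powr (- q / 2)"
    using fractional_solution_decay[OF q \<open>0 < \<kappa>\<close> dissipative] by metis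
  have "norm (x t) < r" if "fractional_solution q F x" "norm (x 0) < r" "0 < t" for x r t
  proof -
    have "((t + T) / T) powr (- q / 2) \<le> 1 powr (- q / 2)"
      using \<open>0 < T\<close> \<open>0 < t\<close> q by (intro powr_mono2') auto
    moreover have "0 < r" using that(2) by (smt (verit) norm_ge_zero)
    ultimately show ?thesis
      using decay[OF that(1,2), of t] \<open>0 < t\<close> by (smt (verit) mult_left_le powr_one_eq_one)
  qed
  then have "stable_equilibrium q F 0"
    using \<open>F 0 = 0\<close> by (auto simp: stable_equilibrium_def equilibrium_state_def)
  moreover have "((\<lambda>t. norm (x t)) \<longlongrightarrow> 0) at_top" if sol: "fractional_solution q F x" for x
  proof (rule tendsto_sandwich[of "\<lambda>_. 0"])
    show "\<forall>\<^sub>F t in at_top. norm (x t) \<le> (norm (x 0) + 1) * ((t + T) / T) powr (- q / 2)"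
      using eventually_ge_at_top[of 0]
      by eventually_elim (rule less_imp_le[OF decay[OF sol]], auto)
    show "((\<lambda>t. (norm (x 0) + 1) * ((t + T) / T) powr (- q / 2)) \<longlongrightarrow> 0) at_top"
      using \<open>0 < T\<close> q by real_asymp
  qed auto
  ultimately show ?thesis
    by (auto simp: asymptotically_stable_equilibrium_def intro!: exI[of _ 1])
qed

section \<open>The Mittag-Leffler function as a Caputo eigenfunction\<close>

text \<open>Log-convexity of Gamma: \<open>y + 1\<close> is the convex combination of
  \<open>y + q\<close> and \<open>y + q + 1\<close> with weights \<open>q\<close> and
  \<open>1 - q\<close>. This is one half of Wendel's inequality and controls Gamma quotients with
  the non-integer shift \<open>q\<close>.\<close>

lemma Gamma_plus1_le:
  fixes q y :: real
  assumes "0 < q" "q < 1" "0 < y"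
  shows "Gamma (y + 1) \<le> Gamma (y + q) * (y + q) powr (1 - q)"
proof -
  have pos: "0 < Gamma (y + q)" "0 < Gamma (y + 1)" using assms by auto
  then have nz: "Gamma (y + q) \<noteq> 0" by simp
  have "y + 1 = (1 - (1 - q)) * (y + q) + (1 - q) * (y + q + 1)"
    by (simp add: algebra_simps)
  then have "ln (Gamma (y + 1)) \<le> (1 - (1 - q)) * ln (Gamma (y + q)) + (1 - q) * ln (Gamma (y + q + 1))"
    using convex_onD[OF log_convex_Gamma_real, of "1 - q" "y + q" "y + q + 1"] assms by simp
  also have "Gamma (y + q + 1) = (y + q) * Gamma (y + q)"
    using assms by (intro Gamma_plus1) (auto elim!: nonpos_Ints_cases)
  also have "ln ((y + q) * Gamma (y + q)) = ln (y + q) + ln (Gamma (y + q))"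
    using assms nz by (simp add: ln_mult)
  also have "(1 - (1 - q)) * ln (Gamma (y + q)) + (1 - q) * (ln (y + q) + ln (Gamma (y + q)))
      = ln (Gamma (y + q)) + (1 - q) * ln (y + q)"
    by (simp add: algebra_simps)
  also have "\<dots> = ln (Gamma (y + q) * (y + q) powr (1 - q))"
    using assms nz by (simp add: ln_mult ln_powr)
  finally show ?thesis
    using pos assms by (subst (asm) ln_le_cancel_iff) auto
qed

text \<open>Ratio test: with \<open>y = n * q + 1\<close> the quotient of consecutive terms is at
  most \<open>\<bar>x\<bar> * (y + q) powr (1 - q) / y\<close> in absolute value, which decays like
  \<open>y powr (- q)\<close>.\<close>

lemma summable_mittag_leffler:
  fixes q x :: real
  assumes q: "0 < q" "q < 1"
  shows "summable (\<lambda>n. x ^ n / Gamma (of_nat n * q + 1))"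
proof -
  have "((\<lambda>n. \<bar>x\<bar> * ((real n * q + 1 + q) powr (1 - q) / (real n * q + 1))) \<longlongrightarrow> \<bar>x\<bar> * 0) sequentially"
    by (rule tendsto_mult_left) (use q in real_asymp)
  then have "eventually (\<lambda>n. \<bar>x\<bar> * ((real n * q + 1 + q) powr (1 - q) / (real n * q + 1)) < 1 / 2) sequentially"
    by (auto dest: order_tendstoD(2)[where a = "1 / 2"])
  then obtain N where N: "\<And>n. n \<ge> N \<Longrightarrow>
      \<bar>x\<bar> * ((real n * q + 1 + q) powr (1 - q) / (real n * q + 1)) < 1 / 2"
    by (auto simp: eventually_sequentially)
  show ?thesis
  proof (rule summable_ratio_test)
    fix n assume "N \<le> n"
    define y where "y = real n * q + 1"
    have "0 < y" using q by (simp add: y_def add_nonneg_pos)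
    then have pos: "0 < Gamma y" "0 < Gamma (y + q)" using q by auto
    have "Gamma (y + 1) = y * Gamma y"
      using \<open>0 < y\<close> by (intro Gamma_plus1) (auto elim!: nonpos_Ints_cases)
    then have "Gamma y / Gamma (y + q) \<le> (y + q) powr (1 - q) / y"
      using Gamma_plus1_le[OF q \<open>0 < y\<close>] \<open>0 < y\<close> pos by (simp add: field_simps)
    then have "\<bar>x\<bar> * (Gamma y / Gamma (y + q)) \<le> \<bar>x\<bar> * ((y + q) powr (1 - q) / y)"
      by (rule mult_left_mono) simp
    also have "\<dots> \<le> 1 / 2" using N[OF \<open>N \<le> n\<close>] by (simp add: y_def)
    finally have "\<bar>x\<bar> * (Gamma y / Gamma (y + q)) * (\<bar>x\<bar> ^ n / Gamma y) \<le> 1 / 2 * (\<bar>x\<bar> ^ n / Gamma y)"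
      using pos by (intro mult_right_mono) auto
    moreover have "real (Suc n) * q + 1 = y + q" by (simp add: y_def algebra_simps)
    ultimately show "norm (x ^ Suc n / Gamma (real (Suc n) * q + 1)) \<le> 1 / 2 * norm (x ^ n / Gamma (real n * q + 1))"
      using pos by (simp add: y_def[symmetric] power_abs abs_mult)
  qed simp
qed

text \<open>The function is the Mittag-Leffler function at \<open>k * t powr q\<close>. Termwise,
  the Caputo derivative lowers the exponent \<open>n * q\<close> to \<open>(n - 1) * q\<close> and
  turns the coefficient \<open>c n\<close> into \<open>k * c (n - 1)\<close>. The lower bound is the
  term \<open>n = 1\<close> of a series with nonnegative terms.\<close>

lemma mittag_leffler_fractional_eigenfunction:
  fixes q k :: real
  assumes q: "0 < q" "q < 1" and "0 < k"
  obtains f :: "real \<Rightarrow> real" where "f 0 = 1"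
    and "\<And>t. 0 < t \<Longrightarrow> caputo_differentiable q f t"
    and "\<And>t. 0 < t \<Longrightarrow> caputo_deriv q f t = k * f t"
    and "\<And>t. 0 < t \<Longrightarrow> k / Gamma (q + 1) * t powr q \<le> f t"
proof -
  define c where "c n = k ^ n / Gamma (of_nat n * q + 1)" for n
  have Gamma_pos: "0 < Gamma (of_nat n * q + 1)" for n
    using q by (intro Gamma_real_pos add_nonneg_pos) auto
  have c_pos: "0 < c n" for n
    using Gamma_pos \<open>0 < k\<close> by (simp add: c_def)
  \<comment> \<open>\<open>E\<close> is an ordinary power series in \<open>y\<close>, so it can be
    differentiated termwise everywhere; the fractional powers enter only through
    \<open>y = s powr q\<close>.\<close>
  define E where "E y = (\<Sum>n. c n * y ^ n)" for y
  define E' where "E' y = (\<Sum>n. diffs c n * y ^ n)" for y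
  have summable_E: "summable (\<lambda>n. c n * y ^ n)" for y
    using summable_mittag_leffler[OF q, of "k * y"] by (simp add: c_def power_mult_distrib)
  have E_deriv: "(E has_real_derivative E' y) (at y)" for y
    unfolding E_def[abs_def] E'_def by (rule termdiffs_strong_converges_everywhere[OF summable_E])
  have summable_E': "summable (\<lambda>n. diffs c n * y ^ n)" for y
    by (rule termdiff_converges_all) (rule summable_E)
  define f where "f s = E (s powr q)" for s
  have f_deriv: "(f has_real_derivative E' (s powr q) * (q * s powr (q - 1))) (at s)" if "0 < s" for s
  proof -
    have "((\<lambda>s. s powr q) has_real_derivative q * s powr (q - 1)) (at s)"
      using that by (auto intro!: derivative_eq_intros)
    then show ?thesis
      unfolding f_def by (rule DERIV_chain2[OF E_deriv])
  qed
  have "continuous_on UNIV E"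
    by (rule DERIV_continuous_on) (rule E_deriv)
  then have f_cont: "continuous_on {0..t} f" for t
    unfolding f_def
  proof (rule continuous_on_compose2)
    show "continuous_on {0..t} (\<lambda>s. s powr q)"
      using q by (auto intro!: continuous_on_powr' continuous_on_id continuous_on_const)
  qed simp
  have E_ge: "k / Gamma (q + 1) * y \<le> E y" if "0 \<le> y" for y
  proof -
    have "(\<Sum>n\<in>{1}. c n * y ^ n) \<le> E y"
      unfolding E_def using that c_pos by (intro sum_le_suminf summable_E) (auto simp: less_imp_le)
    then show ?thesis by (simp add: c_def)
  qed
  have main: "has_bochner_integral lborel
      (\<lambda>s. indicator {0<..<t} s * ((t - s) powr (- q) * deriv f s)) (Gamma (1 - q) * (k * f t))"
    if "0 < t" for t
  proof -
    \<comment> \<open>The constant term drops out on differentiation: \<open>summand n\<close> comes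
      from the term of index \<open>Suc n\<close>, whose derivative has the exponent
      \<open>Suc n * q - 1\<close>.\<close>
    define summand where "summand n s = diffs c n * q *
      (indicator {0<..<t} s * ((t - s) powr (- q) * s powr (of_nat (Suc n) * q - 1)))" for n s
    have diffs_pos: "0 < diffs c n" for n using c_pos by (simp add: diffs_def)
    have diffs_eq: "diffs c n * q * Gamma (of_nat (Suc n) * q) = k ^ Suc n" for n
    proof -
      have "0 < of_nat (Suc n) * q" using q by simp
      then have "Gamma (of_nat (Suc n) * q + 1) = of_nat (Suc n) * q * Gamma (of_nat (Suc n) * q)"
        by (intro Gamma_plus1) (auto elim!: nonpos_Ints_cases)
      then show ?thesis
        using Gamma_pos[of "Suc n"] by (auto simp: diffs_def c_def simp del: of_nat_Suc power_Suc)
    qed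
    \<comment> \<open>The Beta value brings in \<open>Gamma (n * q + 1)\<close> as denominator while
      \<open>diffs_eq\<close> removes the old one, so
      \<open>k ^ Suc n / Gamma (n * q + 1) = k * c n\<close> remains: the index shift that yields
      the eigenvalue.\<close>
    have int_n: "has_bochner_integral lborel (summand n) (Gamma (1 - q) * k * (c n * (t powr q) ^ n))" for n
    proof -
      have "0 < of_nat (Suc n) * q" using q by simp
      have "has_bochner_integral lborel (summand n)
          (diffs c n * q * (t powr (of_nat (Suc n) * q - q) * Beta (of_nat (Suc n) * q) (1 - q)))"
        unfolding summand_def[abs_def]
        by (intro has_bochner_integral_mult_right has_bochner_integral_abel_kernel) (use q that in auto)
      also have "of_nat (Suc n) * q - q = of_nat n * q" by (simp add: algebra_simps)
      also have "t powr (of_nat n * q) = (t powr q) ^ n"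
        using that by (simp add: powr_powr mult.commute flip: powr_realpow)
      also have "Beta (of_nat (Suc n) * q) (1 - q) =
          Gamma (of_nat (Suc n) * q) * Gamma (1 - q) / Gamma (of_nat n * q + 1)"
        by (simp add: Beta_def algebra_simps)
      also have "diffs c n * q * ((t powr q) ^ n *
          (Gamma (of_nat (Suc n) * q) * Gamma (1 - q) / Gamma (of_nat n * q + 1))) =
          (diffs c n * q * Gamma (of_nat (Suc n) * q)) * (t powr q) ^ n * Gamma (1 - q) / Gamma (of_nat n * q + 1)"
        by simp
      also have "\<dots> = Gamma (1 - q) * k * (c n * (t powr q) ^ n)"
        unfolding diffs_eq by (simp add: c_def)
      finally show ?thesis .
    qed
    have summand_nonneg: "0 \<le> summand n s" for n s
      using diffs_pos[of n] q by (simp add: summand_def)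
    have summand_sums: "(\<lambda>n. summand n s) sums (indicator {0<..<t} s * ((t - s) powr (- q) * deriv f s))" for s
    proof (cases "s \<in> {0<..<t}")
      case True
      then have "0 < s" by simp
      have "(s powr q) ^ n * s powr (q - 1) = s powr (of_nat (Suc n) * q - 1)" for n
      proof -
        have "(s powr q) ^ n = s powr (of_nat n * q)"
          using \<open>0 < s\<close> by (simp add: powr_powr mult.commute flip: powr_realpow)
        then show ?thesis by (simp add: algebra_simps flip: powr_add)
      qed
      then have "summand n s = diffs c n * (s powr q) ^ n * (q * s powr (q - 1) * (t - s) powr (- q))" for n
        using True by (simp add: summand_def mult_ac)
      moreover have "(\<lambda>n. diffs c n * (s powr q) ^ n * (q * s powr (q - 1) * (t - s) powr (- q))) sums
          (E' (s powr q) * (q * s powr (q - 1) * (t - s) powr (- q)))"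
        unfolding E'_def by (intro sums_mult2 summable_sums summable_E')
      ultimately show ?thesis
        using True DERIV_imp_deriv[OF f_deriv[OF \<open>0 < s\<close>]] by (simp add: mult_ac)
    qed (simp add: summand_def)
    have sums_f: "(\<lambda>n. Gamma (1 - q) * k * (c n * (t powr q) ^ n)) sums (Gamma (1 - q) * k * f t)"
      unfolding f_def E_def by (intro sums_mult summable_sums summable_E)
    \<comment> \<open>Since \<open>k > 0\<close> makes all summands nonnegative, the absolute
      summability needed to exchange sum and integral is the convergence already known.\<close>
    have norm_summand: "norm (summand n s) = summand n s" for n s
      using summand_nonneg by simp
    have int_summand: "integrable lborel (summand n)"
      and val_summand: "integral\<^sup>L lborel (summand n) = Gamma (1 - q) * k * (c n * (t powr q) ^ n)" for n
      using int_n[of n] by (simp_all add: has_bochner_integral_iff)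
    have summ: "AE s in lborel. summable (\<lambda>n. norm (summand n s))"
      unfolding norm_summand using summand_sums by (auto simp: sums_iff)
    have summ_int: "summable (\<lambda>n. \<integral>s. norm (summand n s) \<partial>lborel)"
      unfolding norm_summand val_summand using sums_f by (rule sums_summable)
    have "(\<lambda>s. \<Sum>n. summand n s) = (\<lambda>s. indicator {0<..<t} s * ((t - s) powr (- q) * deriv f s))"
      using summand_sums by (auto simp: sums_iff)
    moreover have "(\<Sum>n. integral\<^sup>L lborel (summand n)) = Gamma (1 - q) * (k * f t)"
      using sums_f by (simp add: val_summand sums_iff mult_ac)
    ultimately show ?thesis
      using integrable_suminf[OF int_summand summ summ_int] integral_suminf[OF int_summand summ summ_int]
      by (simp add: has_bochner_integral_iff)
  qed
  show thesis
  proof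
    \<comment> \<open>As \<open>0 powr q = 0\<close>, only the constant coefficient survives at time
      \<open>0\<close>.\<close>
    have "c 0 = 1" by (simp add: c_def)
    then show "f 0 = 1" by (simp add: f_def E_def)
    fix t :: real assume "0 < t"
    have f_diff: "f differentiable (at s)" if "0 < s" for s
      using f_deriv[OF that] by (auto simp: real_differentiable_def)
    show "caputo_differentiable q f t"
      using main[OF \<open>0 < t\<close>] f_cont f_diff
      by (auto simp: caputo_differentiable_def set_integrable_def has_bochner_integral_iff)
    have "Gamma (1 - q) \<noteq> 0"
      using q Gamma_real_pos[of "1 - q"] by linarith
    then show "caputo_deriv q f t = k * f t"
      using main[OF \<open>0 < t\<close>]
      by (simp add: caputo_deriv_def set_lebesgue_integral_def has_bochner_integral_iff)
    show "k / Gamma (q + 1) * t powr q \<le> f t"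
      unfolding f_def by (rule E_ge) simp
  qed
qed

section \<open>Instability along an invariant line\<close>

lemma
  assumes "caputo_differentiable q f t"
  shows caputo_differentiable_cmult: "caputo_differentiable q (\<lambda>s. f s * c) t"
    and caputo_deriv_cmult: "caputo_deriv q (\<lambda>s. f s * c) t = caputo_deriv q f t * c"
proof -
  \<comment> \<open>Pulling the constant out of \<open>deriv\<close> uses differentiability, which
    is available inside the interval; outside it the indicator makes both sides vanish.\<close>
  have *: "indicator {0<..<t} s *\<^sub>R ((t - s) powr (- q) * deriv (\<lambda>s. f s * c) s) =
      indicator {0<..<t} s *\<^sub>R ((t - s) powr (- q) * deriv f s) * c" for s
  proof (cases "s \<in> {0<..<t}")
    case True
    then have "f field_differentiable at s"
      using assms by (auto simp: caputo_differentiable_def field_differentiable_def real_differentiable_def)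
    then show ?thesis by simp
  qed simp
  show "caputo_differentiable q (\<lambda>s. f s * c) t"
    using assms unfolding caputo_differentiable_def set_integrable_def *
    by (auto intro!: continuous_intros differentiable_mult)
  show "caputo_deriv q (\<lambda>s. f s * c) t = caputo_deriv q f t * c"
    unfolding caputo_deriv_def set_lebesgue_integral_def * by simp
qed

text \<open>On the line through \<open>v\<close> the system is the scalar equation with eigenvalue
  \<open>k\<close>, so every multiple of the eigenfunction times \<open>v\<close> is a solution, and
  it grows at least like \<open>t powr q\<close>.\<close>

lemma unstable_if_unstable_eigenray:
  fixes F :: "real^'n \<Rightarrow> real^'n"
  assumes q: "0 < q" "q < 1" and "0 < k" and "v \<noteq> 0"
    and eigen: "\<And>s. F (s *\<^sub>R v) = (k * s) *\<^sub>R v"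
  shows "unstable_equilibrium q F 0"
proof -
  obtain f :: "real \<Rightarrow> real" where f: "f 0 = 1"
    "\<And>t. 0 < t \<Longrightarrow> caputo_differentiable q f t"
    "\<And>t. 0 < t \<Longrightarrow> caputo_deriv q f t = k * f t"
    "\<And>t. 0 < t \<Longrightarrow> k / Gamma (q + 1) * t powr q \<le> f t"
    using mittag_leffler_fractional_eigenfunction[OF q \<open>0 < k\<close>] by metis
  have "\<not> stable_equilibrium q F 0"
  proof
    assume "stable_equilibrium q F 0"
    then obtain \<delta> where "0 < \<delta>"
      and \<delta>: "\<And>x t. fractional_solution q F x \<Longrightarrow> norm (x 0) < \<delta> \<Longrightarrow> 0 < t \<Longrightarrow> norm (x t) < 1"
      unfolding stable_equilibrium_def by (metis diff_zero zero_less_one)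
    \<comment> \<open>The initial norm becomes \<open>\<delta> / 2\<close>; the bound to be violated
      is \<open>\<epsilon> = 1\<close>.\<close>
    define c where "c = \<delta> / (2 * norm v)"
    have c: "0 < c" "c * norm v < \<delta>"
      using \<open>0 < \<delta>\<close> \<open>v \<noteq> 0\<close> by (auto simp: c_def)
    define x where "x s = (f s * c) *\<^sub>R v" for s
    have comp: "x s $ i = f s * (c * v $ i)" for s i
      by (simp add: x_def)
    have "fractional_solution q F x"
      unfolding fractional_solution_def comp
      by (auto simp: caputo_differentiable_cmult caputo_deriv_cmult f x_def eigen)
    moreover have "norm (x 0) < \<delta>"
      using c by (simp add: x_def f)
    ultimately have bound: "norm (x t) < 1" if "0 < t" for t
      using \<delta> that by blast
    define C where "C = k / Gamma (q + 1) * (c * norm v)"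
    have "0 < C" using q \<open>0 < k\<close> c \<open>v \<noteq> 0\<close> by (simp add: C_def)
    then have "filterlim (\<lambda>t. C * t powr q) at_top at_top"
      using q by real_asymp
    then have "filterlim (\<lambda>t. k / Gamma (q + 1) * t powr q * (c * norm v)) at_top at_top"
      by (simp add: C_def mult_ac)
    then have "eventually (\<lambda>t. 1 \<le> k / Gamma (q + 1) * t powr q * (c * norm v)) at_top"
      by (simp add: filterlim_at_top)
    then obtain t where t: "0 < t" "1 \<le> k / Gamma (q + 1) * t powr q * (c * norm v)"
      using eventually_happens'[OF _ eventually_conj[OF _ eventually_gt_at_top[of 0]]] by force
    have "1 \<le> k / Gamma (q + 1) * t powr q * (c * norm v)" by (rule t)
    also have "\<dots> \<le> f t * (c * norm v)"
      using f(4)[OF t(1)] c by (intro mult_right_mono) auto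
    also have "\<dots> \<le> norm (x t)"
      using c by (simp add: x_def abs_mult mult_ac mult_left_mono)
    finally show False using bound[OF t(1)] by simp
  qed
  moreover have "F 0 = 0" using eigen[of 0] by simp
  ultimately show ?thesis
    by (simp add: unstable_equilibrium_def equilibrium_state_def)
qed

section \<open>The controlled Stokes system\<close>

theorem corollary4p1:
  fixes l1 l2 l3 k1 k2 q :: real
  assumes "l1 \<noteq> l2" and "l2 \<noteq> l3" and "l1 \<noteq> l3"
    and "k1 \<noteq> 0" and "k2 \<noteq> 0"
    and "0 < q" and "q < 1"
  shows "(k1 < 0 \<and> k2 < 0 \<longrightarrow>
            asymptotically_stable_equilibrium q (controlled_stokes l1 l2 l3 k1 k2) 0) \<and>
         (k1 > 0 \<and> k2 < 0 \<longrightarrow>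
            unstable_equilibrium q (controlled_stokes l1 l2 l3 k1 k2) 0) \<and>
         (k2 > 0 \<longrightarrow>
            unstable_equilibrium q (controlled_stokes l1 l2 l3 k1 k2) 0)"
proof (intro conjI impI)
  let ?F = "controlled_stokes l1 l2 l3 k1 k2"
  show "asymptotically_stable_equilibrium q ?F 0" if neg: "k1 < 0 \<and> k2 < 0"
  proof (rule asymptotically_stable_if_dissipative[OF \<open>0 < q\<close> \<open>q < 1\<close>, of "min (- k1) (- k2)"])
    show "?F 0 = 0"
      by (simp add: controlled_stokes_def vec_eq_iff forall_3)
    fix u :: "real^3"
    define \<kappa> where "\<kappa> = min (- k1) (- k2)"
    have "u \<bullet> ?F u = k1 * (u $ 1)\<^sup>2 + k2 * (u $ 2)\<^sup>2 + k1 * (u $ 3)\<^sup>2"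
      by (simp add: inner_vec_def sum_3 controlled_stokes_def power2_eq_square algebra_simps)
    \<comment> \<open>Each coefficient \<open>k1\<close>, \<open>k2\<close> is at most
      \<open>- \<kappa>\<close>, the larger of the two.\<close>
    also have "\<dots> \<le> - \<kappa> * (u $ 1)\<^sup>2 + - \<kappa> * (u $ 2)\<^sup>2 + - \<kappa> * (u $ 3)\<^sup>2"
      by (intro add_mono mult_right_mono) (auto simp: \<kappa>_def)
    also have "\<dots> = - \<kappa> * (norm u)\<^sup>2"
      unfolding power2_norm_eq_inner inner_vec_def sum_3
      by (simp add: power2_eq_square algebra_simps)
    finally show "u \<bullet> ?F u \<le> - min (- k1) (- k2) * (norm u)\<^sup>2"
      by (simp add: \<kappa>_def)
  qed (use neg in auto)
  \<comment> \<open>On a coordinate axis all products of two different coordinates vanish, leaving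
    the factor \<open>k1\<close> on the first axis and \<open>k2\<close> on the second.\<close>
  show "unstable_equilibrium q ?F 0" if "k1 > 0 \<and> k2 < 0"
    by (rule unstable_if_unstable_eigenray[OF \<open>0 < q\<close> \<open>q < 1\<close>, of k1 "axis 1 1"])
       (use that in \<open>auto simp: controlled_stokes_def vec_eq_iff forall_3 axis_def\<close>)
  show "unstable_equilibrium q ?F 0" if "k2 > 0"
    by (rule unstable_if_unstable_eigenray[OF \<open>0 < q\<close> \<open>q < 1\<close>, of k2 "axis 2 1"])
       (use that in \<open>auto simp: controlled_stokes_def vec_eq_iff forall_3 axis_def\<close>)
qed

end
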